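(* The components of $H^c$ are unbounded if and only if there is a non-zero loop in $\mathcal{G}_k$ for some $k\ge 0$.
   Context: Let $n\ge 2$ be an integer and $\mathcal{D}\subset\{0,1,\dots,n-1\}^2$ with $1<\#\mathcal{D}<n^2$. The fractal square $F\subset\mathbb{R}^2$ is the unique non-empty compact set with $F=(F+\mathcal{D})/n$; $H=F+\mathbb{Z}^2$ and $H^c=\mathbb{R}^2\setminus H$. "Component" means connected component. Let $I=[0,1]^2$ with interior $I^\circ$, $F_1=(I+\mathcal{D})/n$, and $F_{k+1}=(F_k+\mathcal{D})/n$ for $k\ge1$. For $q\in\mathbb{Z}^2$, $k\ge 1$, let $H_k(0,q)=F_k+(\mathbb{Z}^2\setminus\{0,q\})$ and let $H_k^c(0,q)$ be its complement in $\mathbb{R}^2$. For $k\ge1$, $Q_k$ is the set of $q\in\mathbb{Z}^2$ such that some connected component of $H_k^c(0,q)$ contains both $I^\circ$ and $q+I^\circ$. By convention $Q_0=\{0,\pm e_1,\pm e_2\}$, $e_1=(1,0)$, $e_2=(0,1)$. Let $\mathcal{D}^c=\{0,\dots,n-1\}^2\setminus\mathcal{D}$ and $\mathcal{V}=\mathcal{D}^c/n$. The graph $\mathcal{G}_k=\mathcal{G}_{Q_k}$ has vertex set $\mathcal{V}$ and edges the triples $(u,v;b)$ (an edge $b$ from $u$ to $v$) with $u,v\in\mathcal{V}$, $b\in\mathbb{Z}^2$, $n(v+b-u)\in Q_k$. A path is a finite sequence of edges $\{(u_i,u_{i+1};b_i)\}_{i=1}^m$ of the graph; it is a loop if $u_1=u_{m+1}$,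 and a non-zero loop if in addition $\sum_{i=1}^m b_i\ne 0$. *)

theory Defs
  imports "HOL-Analysis.Analysis" "Graph_Theory.Arc_Walk"
begin

text \<open>The plane is \<^typ>\<open>real \<times> real\<close> (with its Euclidean topology) and the integer lattice is
  \<^typ>\<open>int \<times> int\<close>, embedded by the following map.\<close>

definition emb :: "int \<times> int \<Rightarrow> real \<times> real" where
  "emb p = (real_of_int (fst p), real_of_int (snd p))"

definition lattice_translates :: "(real \<times> real) set \<Rightarrow> (int \<times> int) set \<Rightarrow> (real \<times> real) set" where
  "lattice_translates A S = {x + emb p | x p. x \<in> A \<and> p \<in> S}"

definition digit_grid :: "nat \<Rightarrow> (int \<times> int) set" where
  "digit_grid n = {0..<int n} \<times> {0..<int n}"

definition subdivide :: "nat \<Rightarrow> (int \<times> int) set \<Rightarrow> (real \<times> real) set \<Rightarrow> (real \<times> real) set" where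
  "subdivide n D A = (\<lambda>x. (1 / real n) *\<^sub>R x) ` lattice_translates A D"

text \<open>For \<open>n \<ge> 2\<close> and finite non-empty \<open>D\<close>, Hutchinson's theorem gives exactly one set \<open>F\<close> with this
  property.\<close>

definition is_fractal_square :: "nat \<Rightarrow> (int \<times> int) set \<Rightarrow> (real \<times> real) set \<Rightarrow> bool" where
  "is_fractal_square n D F \<longleftrightarrow> compact F \<and> F \<noteq> {} \<and> F = subdivide n D F"

definition unit_square :: "(real \<times> real) set" where
  "unit_square = cbox (0, 0) (1, 1)"

definition approx_square :: "nat \<Rightarrow> (int \<times> int) set \<Rightarrow> nat \<Rightarrow> (real \<times> real) set" where
  "approx_square n D k = (subdivide n D ^^ k) unit_square"

definition approx_ext :: "nat \<Rightarrow> (int \<times> int) set \<Rightarrow> nat \<Rightarrow> int \<times> int \<Rightarrow> (real \<times> real) set" where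
  "approx_ext n D k q = lattice_translates (approx_square n D k) (UNIV - {0, q})"

definition Qset :: "nat \<Rightarrow> (int \<times> int) set \<Rightarrow> nat \<Rightarrow> (int \<times> int) set" where
  "Qset n D k =
     (if k = 0 then {(0, 0), (1, 0), (-1, 0), (0, 1), (0, -1)}
      else {q. \<exists>C \<in> components (- approx_ext n D k q).
                 interior unit_square \<subseteq> C \<and> lattice_translates (interior unit_square) {q} \<subseteq> C})"

text \<open>An arc is a triple \<open>(u, v, b)\<close>: an edge from \<open>u\<close> to \<open>v\<close> labelled by the lattice vector \<open>b\<close>.
  There may be several arcs, with different labels, between the same two vertices.\<close>

type_synonym labelled_arc = "(real \<times> real) \<times> (real \<times> real) \<times> (int \<times> int)"

definition arc_label :: "labelled_arc \<Rightarrow> int \<times> int" where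
  "arc_label e = snd (snd e)"

definition vertex_set :: "nat \<Rightarrow> (int \<times> int) set \<Rightarrow> (real \<times> real) set" where
  "vertex_set n D = (\<lambda>d. (1 / real n) *\<^sub>R emb d) ` (digit_grid n - D)"

definition graph_of ::
  "nat \<Rightarrow> (int \<times> int) set \<Rightarrow> (int \<times> int) set \<Rightarrow> (real \<times> real, labelled_arc) pre_digraph" where
  "graph_of n D Q =
     \<lparr> verts = vertex_set n D,
       arcs = {(u, v, b). u \<in> vertex_set n D \<and> v \<in> vertex_set n D \<and>
                          real n *\<^sub>R (v + emb b - u) \<in> emb ` Q},
       tail = fst,
       head = fst \<circ> snd \<rparr>"

definition has_nonzero_loop :: "(real \<times> real, labelled_arc) pre_digraph \<Rightarrow> bool" where
  "has_nonzero_loop G \<longleftrightarrow>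
     (\<exists>u p. p \<noteq> [] \<and> pre_digraph.awalk G u p u \<and> sum_list (map arc_label p) \<noteq> 0)"

end

theory Submission
  imports Defs
begin

text \<open>
  An unbounded component of \<open>- H\<close> meets infinitely many unit squares, hence two distinct ones that
  differ by \<open>n b\<close> with \<open>b \<in> \<int>\<^sup>2\<close>. A path between them inside \<open>- H\<close> avoids some approximation of
  \<open>H\<close>, so \<open>n b \<in> Q\<^sub>k\<close> for some \<open>k\<close>, and every vertex carries a one-edge loop labelled \<open>b\<close>.

  Conversely, an edge \<open>(u, v; b)\<close> joins the centres of the empty squares at \<open>u\<close> and \<open>v + b\<close>
  inside \<open>- H\<close>, so a non-zero loop yields a component of \<open>- H\<close> with a non-zero period, which is
  unbounded. One unbounded component \<open>C\<close> suffices: since \<open>H \<supseteq> n\<^sup>k H\<close>, every component of \<open>- H\<close>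
  magnified by \<open>n\<^sup>k\<close> contains, for large \<open>k\<close>, a ball of radius 2; this ball meets a lattice translate
  of \<open>C\<close>, which avoids \<open>H\<close> and so lies in the magnified component.
\<close>

section \<open>Lattice translates\<close>

lemma emb_simps [simp]:
  "emb 0 = 0" "emb (p + q) = emb p + emb q" "emb (p - q) = emb p - emb q" "emb (- p) = - emb p"
  by (auto simp: emb_def zero_prod_def plus_prod_def minus_prod_def uminus_prod_def)

lemma emb_eq_iff [simp]: "emb p = emb q \<longleftrightarrow> p = q"
  by (auto simp: emb_def prod_eq_iff)

lemma scaleR_emb: "real n *\<^sub>R emb p = emb (int n * fst p, int n * snd p)"
  by (simp add: emb_def)

lemma mem_lattice_translates: "x \<in> lattice_translates A S \<longleftrightarrow> (\<exists>p\<in>S. x - emb p \<in> A)"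
proof
  assume "\<exists>p\<in>S. x - emb p \<in> A"
  then obtain p where "p \<in> S" "x - emb p \<in> A" by blast
  moreover have "x = (x - emb p) + emb p" by simp
  ultimately show "x \<in> lattice_translates A S" unfolding lattice_translates_def by blast
next
  assume "x \<in> lattice_translates A S"
  then obtain y p where "x = y + emb p" "y \<in> A" "p \<in> S"
    unfolding lattice_translates_def by blast
  then show "\<exists>p\<in>S. x - emb p \<in> A" by (metis add_diff_cancel_right')
qed

lemma lattice_translates_mono:
  "A \<subseteq> B \<Longrightarrow> S \<subseteq> T \<Longrightarrow> lattice_translates A S \<subseteq> lattice_translates B T"
  unfolding lattice_translates_def by blast

lemma lattice_translates_UNIV_periodic:
  "x + emb p \<in> lattice_translates A UNIV \<longleftrightarrow> x \<in> lattice_translates A UNIV"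
proof -
  have "x - emb q = x + emb p - emb (q + p)" "x + emb p - emb q = x - emb (q - p)" for q
    by (simp_all add: algebra_simps)
  then show ?thesis by (metis UNIV_I mem_lattice_translates)
qed

lemma closed_range_emb: "closed (range emb)"
proof -
  have "range emb = (\<int> :: real set) \<times> (\<int> :: real set)"
    by (auto simp: emb_def Ints_def image_iff)
  then show ?thesis by (simp add: closed_Times closed_Ints)
qed

lemma closed_lattice_translates_UNIV:
  assumes "compact A" shows "closed (lattice_translates A UNIV)"
proof -
  have "lattice_translates A UNIV = (\<Union>x\<in>A. \<Union>y\<in>range emb. {x + y})"
    by (auto simp: lattice_translates_def)
  then show ?thesis using compact_closed_sums[OF assms closed_range_emb] by simp
qed

text \<open>The lattice point \<open>z\<close> whose half-open square \<open>z + [0,1)^2\<close>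
  contains the given point. It serves both to round to the lattice and to index the squares that a
  set meets.\<close>

definition floor_vec :: "real \<times> real \<Rightarrow> int \<times> int" where
  "floor_vec x = (\<lfloor>fst x\<rfloor>, \<lfloor>snd x\<rfloor>)"

text \<open>The sharp bound is sqrt 2; the value 2 is a convenient strict bound, used below for
  rounding errors and for distances within the unit square.\<close>

lemma norm_lt_2_if_coords_le_1:
  fixes x :: "real \<times> real"
  assumes "\<bar>fst x\<bar> \<le> 1" "\<bar>snd x\<bar> \<le> 1" shows "norm x < 2"
proof -
  have "(fst x)\<^sup>2 \<le> 1" "(snd x)\<^sup>2 \<le> 1" using assms by (simp_all add: abs_square_le_1)
  then have "norm x \<le> sqrt 2" by (simp add: norm_prod_def)
  also have "\<dots> < 2" by (rule real_less_lsqrt) auto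
  finally show ?thesis .
qed

lemma dist_floor_vec: "dist x (emb (floor_vec x)) < 2"
  unfolding dist_norm by (rule norm_lt_2_if_coords_le_1) (auto simp: emb_def floor_vec_def; linarith)+

lemma infinite_floor_vec_image:
  assumes "\<not> bounded C" shows "infinite (floor_vec ` C)"
proof
  assume "finite (floor_vec ` C)"
  then have "bounded (\<Union>z \<in> floor_vec ` C. ball (emb z) 2)" by (intro bounded_UN) auto
  moreover have "C \<subseteq> (\<Union>z \<in> floor_vec ` C. ball (emb z) 2)"
    using dist_floor_vec by (auto simp: dist_commute)
  ultimately show False using assms bounded_subset by blast
qed

section \<open>Transport of connections by continuous maps\<close>

lemma connected_component_image:
  assumes "connected_component S x y" "continuous_on S f" "f ` S \<subseteq> T"
  shows "connected_component T (f x) (f y)"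
proof -
  obtain K where "connected K" "K \<subseteq> S" "x \<in> K" "y \<in> K"
    using assms(1) unfolding connected_component_def by blast
  then show ?thesis unfolding connected_component_def
    using assms(2,3) by (intro exI[of _ "f ` K"])
      (auto intro: connected_continuous_image continuous_on_subset)
qed

lemma connected_component_translate:
  fixes a :: "'a::real_normed_vector"
  assumes "connected_component S x y" "\<And>z. z \<in> S \<Longrightarrow> z + a \<in> S"
  shows "connected_component S (x + a) (y + a)"
proof (rule connected_component_image[OF assms(1)])
  show "continuous_on S (\<lambda>z. z + a)" by (intro continuous_intros)
qed (use assms(2) in blast)

section \<open>Closed periodic sets that are expanded into themselves\<close>

text \<open>One unbounded component decides all. Instead of magnifying \<open>A\<close>, the proof
  shrinks: a small ball about \<open>x\<close> and a translate of \<open>C\<close> scaled by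
  \<open>1 / N\<close> form a connected set \<open>K\<close> in \<open>- H\<close>. It lies in
  \<open>A\<close>, so bounded \<open>A\<close> would make \<open>C\<close> bounded.\<close>

lemma all_components_unbounded:
  fixes H :: "(real \<times> real) set"
  assumes n: "n \<ge> 2" and "closed H"
    and per: "\<And>x p. x + emb p \<in> H \<longleftrightarrow> x \<in> H"
    and expand: "\<And>x. x \<in> H \<Longrightarrow> real n *\<^sub>R x \<in> H"
    and C: "C \<in> components (- H)" "\<not> bounded C"
    and A: "A \<in> components (- H)"
  shows "\<not> bounded A"
proof
  assume "bounded A"
  obtain x where x: "x \<in> A" "x \<notin> H" and A_eq: "A = connected_component_set (- H) x"
    using A by (auto simp: components_def)
  obtain c where c: "c \<in> C" using C(1) in_components_nonempty by blast
  obtain r where r: "r > 0" "ball x r \<inter> H = {}"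
    using \<open>closed H\<close> x(2) by (metis Compl_iff disjoint_eq_subset_Compl open_Compl openE)
  \<comment> \<open>The ball of radius \<open>r\<close> must magnify to a radius above 2, the
    rounding error of \<open>floor_vec\<close>.\<close>
  obtain k where k: "2 / r < real n ^ k" using n real_arch_pow[of "real n" "2 / r"] by auto
  define N where "N = real n ^ k"
  have N: "N > 0" "N * r > 2" using n k r by (auto simp: N_def field_simps)
  have expandN: "N *\<^sub>R y \<in> H" if "y \<in> H" for y
    unfolding N_def
  proof (induction k)
    case (Suc k)
    then show ?case using expand[of "real n ^ k *\<^sub>R y"] by simp
  qed (use that in simp)
  text \<open>Since \<open>H \<supseteq> N H\<close>, a lattice translate of \<open>C\<close> through the ball around \<open>N x\<close> avoids \<open>N H\<close>.\<close>
  define p where "p = floor_vec (N *\<^sub>R x - c)"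
  define C' where "C' = (\<lambda>y. y + emb p) ` C"
  define K where "K = (\<lambda>y. (1 / N) *\<^sub>R y) ` (ball (N *\<^sub>R x) (N * r) \<union> C')"
  have "dist (N *\<^sub>R x) (c + emb p) < N * r"
    using dist_floor_vec[of "N *\<^sub>R x - c"] N by (simp add: p_def dist_norm algebra_simps)
  then have "c + emb p \<in> ball (N *\<^sub>R x) (N * r) \<inter> C'" using c by (auto simp: C'_def)
  moreover have "connected C'" unfolding C'_def
    using C(1) by (intro connected_continuous_image continuous_intros) (rule in_components_connected)
  ultimately have "connected (ball (N *\<^sub>R x) (N * r) \<union> C')" by (intro connected_Un) auto
  then have "connected K" unfolding K_def by (intro connected_continuous_image continuous_intros)
  moreover have "K \<subseteq> - H"
  proof
    fix y assume "y \<in> K"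
    then have y: "N *\<^sub>R y \<in> ball (N *\<^sub>R x) (N * r) \<union> C'" using N by (auto simp: K_def)
    have "y \<notin> H" if "N *\<^sub>R y \<in> ball (N *\<^sub>R x) (N * r)"
    proof -
      have "dist (N *\<^sub>R x) (N *\<^sub>R y) = N * dist x y"
        using N by (simp add: dist_norm flip: scaleR_diff_right)
      then have "y \<in> ball x r" using that N by auto
      then show ?thesis using r by auto
    qed
    moreover have "N *\<^sub>R y \<notin> H" if Ny: "N *\<^sub>R y \<in> C'"
    proof -
      obtain w where "w \<in> C" "N *\<^sub>R y = w + emb p" using Ny unfolding C'_def by blast
      then show ?thesis using in_components_subset[OF C(1)] per[of w p] by auto
    qed
    ultimately show "y \<in> - H" using y expandN by blast
  qed
  moreover have "x \<in> K" using N r by (auto simp: K_def image_iff intro!: bexI[of _ "N *\<^sub>R x"])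
  ultimately have "K \<subseteq> A" unfolding A_eq by (intro connected_component_maximal)
  then have "bounded K" using \<open>bounded A\<close> bounded_subset by blast
  have "C \<subseteq> (\<lambda>y. N *\<^sub>R y - emb p) ` K"
  proof
    fix y assume "y \<in> C"
    then have "(1 / N) *\<^sub>R (y + emb p) \<in> K" by (auto simp: K_def C'_def)
    then show "y \<in> (\<lambda>y. N *\<^sub>R y - emb p) ` K"
      using N by (intro image_eqI[of _ _ "(1 / N) *\<^sub>R (y + emb p)"]) auto
  qed
  moreover have "bounded ((\<lambda>y. N *\<^sub>R y - emb p) ` K)"
    using bounded_translation[OF bounded_scaling[OF \<open>bounded K\<close>, of N], of "- emb p"]
    by (simp add: image_image add.commute)
  ultimately show False using C(2) bounded_subset by blast
qed

text \<open>Translates of the connection from \<open>c\<close> to \<open>c + b\<close> chain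
  together, so the component contains every \<open>c + j b\<close>, and these points escape to
  infinity.\<close>

lemma period_imp_unbounded_component:
  fixes H :: "(real \<times> real) set"
  assumes per: "\<And>x p. x + emb p \<in> H \<longleftrightarrow> x \<in> H"
    and conn: "connected_component (- H) c (c + emb b)" and "b \<noteq> 0"
  shows "connected_component_set (- H) c \<in> components (- H)"
    and "\<not> bounded (connected_component_set (- H) c)"
proof -
  have c: "c \<in> - H" using conn connected_component_in by blast
  then show "connected_component_set (- H) c \<in> components (- H)" by (auto simp: components_def)
  have steps: "connected_component (- H) c (c + real j *\<^sub>R emb b)" for j :: nat
  proof (induction j)
    case 0
    then show ?case using c by (simp add: connected_component_refl_eq)
  next
    case (Suc j)
    have "connected_component (- H) (c + emb b) (c + real j *\<^sub>R emb b + emb b)"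
      using connected_component_translate[OF Suc] per by (metis Compl_iff)
    then show ?case using connected_component_trans[OF conn] by (simp add: algebra_simps)
  qed
  show "\<not> bounded (connected_component_set (- H) c)"
  proof
    assume "bounded (connected_component_set (- H) c)"
    then obtain M where M: "\<And>y. connected_component (- H) c y \<Longrightarrow> dist c y \<le> M"
      unfolding bounded_any_center[of _ c] by auto
    have "emb b \<noteq> 0" using \<open>b \<noteq> 0\<close> emb_eq_iff[of b 0] by simp
    then obtain j :: nat where "M < real j * norm (emb b)"
      using reals_Archimedean3[of "norm (emb b)"] by auto
    then show False using M[OF steps[of j]] by (simp add: dist_norm)
  qed
qed

section \<open>Fractal squares and their approximations\<close>

lemma mem_subdivide:
  assumes "n > 0"
  shows "x \<in> subdivide n D A \<longleftrightarrow> (\<exists>d\<in>D. real n *\<^sub>R x - emb d \<in> A)"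
proof -
  have "x \<in> subdivide n D A \<longleftrightarrow> real n *\<^sub>R x \<in> lattice_translates A D"
    using assms by (force simp: subdivide_def)
  then show ?thesis by (simp add: mem_lattice_translates)
qed

lemma subdivide_mono: "A \<subseteq> B \<Longrightarrow> subdivide n D A \<subseteq> subdivide n D B"
  unfolding subdivide_def by (intro image_mono lattice_translates_mono) auto

section \<open>Geometry of the unit square and of the digits\<close>

lemma mem_unit_square:
  "x \<in> unit_square \<longleftrightarrow> 0 \<le> fst x \<and> fst x \<le> 1 \<and> 0 \<le> snd x \<and> snd x \<le> 1"
  unfolding unit_square_def by (cases x) (auto simp: cbox_Pair_eq)

lemma mem_interior_unit_square:
  "x \<in> interior unit_square \<longleftrightarrow> 0 < fst x \<and> fst x < 1 \<and> 0 < snd x \<and> snd x < 1"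
proof -
  have "interior unit_square = {0<..<1} \<times> {0<..<1}"
    by (simp add: unit_square_def cbox_Pair_eq interior_Times)
  then show ?thesis by (cases x) auto
qed

text \<open>The point may lie on the lower or left edge of its half-open square; a small diagonal
  push moves it inside.\<close>

lemma open_meets_floor_square:
  assumes "open C" "x \<in> C"
  shows "\<exists>y\<in>C. y - emb (floor_vec x) \<in> interior unit_square"
proof -
  obtain r where r: "r > 0" "ball x r \<subseteq> C" using assms by (meson openE)
  \<comment> \<open>Half of \<open>r\<close> suffices because \<open>(t, t)\<close> has norm below
    \<open>2 * t\<close>; half of the gaps to the right and upper edges keeps the pushed point short
    of them.\<close>
  define t where "t = min (r / 2) (min ((1 - frac (fst x)) / 2) ((1 - frac (snd x)) / 2))"
  have t: "t > 0" "t \<le> r / 2" "t \<le> (1 - frac (fst x)) / 2" "t \<le> (1 - frac (snd x)) / 2"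
    using r frac_lt_1[of "fst x"] frac_lt_1[of "snd x"]
    by (simp_all add: t_def min_le_iff_disj del: le_divide_eq_numeral1)
  have "norm (t, t) = t * norm (1 :: real, 1 :: real)"
    using norm_scaleR[of t "(1 :: real, 1 :: real)"] t(1) by simp
  also have "\<dots> < t * 2" using t(1) by (intro mult_strict_left_mono norm_lt_2_if_coords_le_1) auto
  finally have "dist (x + (t, t)) x < r" using t(2) by (simp add: dist_norm)
  then have "x + (t, t) \<in> ball x r" by (simp add: dist_commute)
  moreover have "x + (t, t) - emb (floor_vec x) \<in> interior unit_square"
  proof -
    have "0 < s + t - real_of_int \<lfloor>s\<rfloor> \<and> s + t - real_of_int \<lfloor>s\<rfloor> < 1"
      if "t \<le> (1 - frac s) / 2" for s
      using that t(1) frac_lt_1[of s] of_int_floor_le[of s] unfolding frac_def by argo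
    from this[OF t(3)] this[OF t(4)] show ?thesis
      unfolding mem_interior_unit_square emb_def floor_vec_def
        fst_add snd_add fst_diff snd_diff fst_conv snd_conv by blast
  qed
  ultimately show ?thesis using r(2) by blast
qed

lemma convex_interior_unit_square: "convex (interior unit_square)"
  by (simp add: unit_square_def convex_interior)

lemma integer_shift_inside_unit_interval:
  fixes s :: real and i :: int
  assumes "0 < s" "s < 1" "0 \<le> s - i" "s - i \<le> 1"
  shows "i = 0"
proof -
  have "real_of_int i < 1" "real_of_int i > -1" using assms by linarith+
  then show ?thesis by linarith
qed

lemma interior_unit_square_disjoint_shift:
  assumes "x \<in> interior unit_square" "x - emb p \<in> unit_square" shows "p = 0"
  using assms integer_shift_inside_unit_interval[of "fst x" "fst p"]
    integer_shift_inside_unit_interval[of "snd x" "snd p"]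
  by (auto simp: mem_unit_square mem_interior_unit_square emb_def prod_eq_iff)

lemma subdivide_unit_square:
  assumes "n > 0" "D \<subseteq> digit_grid n" shows "subdivide n D unit_square \<subseteq> unit_square"
proof
  have bound: "0 \<le> t \<and> t \<le> 1" if "0 \<le> i" "i < int n" "0 \<le> n * t - i" "n * t - i \<le> 1"
    for t :: real and i :: int
  proof -
    have "real_of_int i \<le> real n - 1" using that by linarith
    then have "0 \<le> n * t" "n * t \<le> n * 1" using that by linarith+
    then show ?thesis using \<open>n > 0\<close> by (simp add: zero_le_mult_iff)
  qed
  fix x assume "x \<in> subdivide n D unit_square"
  then obtain d where "d \<in> digit_grid n" "real n *\<^sub>R x - emb d \<in> unit_square"
    using assms by (auto simp: mem_subdivide)
  then show "x \<in> unit_square"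
    using bound[of "fst d" "fst x"] bound[of "snd d" "snd x"]
    by (auto simp: digit_grid_def mem_unit_square emb_def)
qed

lemma approx_square_Suc: "approx_square n D (Suc k) = subdivide n D (approx_square n D k)"
  by (simp add: approx_square_def)

lemma approx_square_subset_unit_square:
  assumes "n > 0" "D \<subseteq> digit_grid n" shows "approx_square n D k \<subseteq> unit_square"
proof (induction k)
  case (Suc k)
  then show ?case using subdivide_mono[OF Suc] subdivide_unit_square[OF assms]
    by (metis approx_square_Suc subset_trans)
qed (simp add: approx_square_def)

text \<open>An open lattice square meets no closed lattice square but its own, and exactly the
  translates at 0 and \<open>q\<close> are left out of \<open>approx_ext\<close>.\<close>

lemma interior_unit_square_subset_approx_ext:
  assumes "n > 0" "D \<subseteq> digit_grid n"
  shows "interior unit_square \<subseteq> - approx_ext n D k q"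
    and "lattice_translates (interior unit_square) {q} \<subseteq> - approx_ext n D k q"
proof -
  have *: "r = p"
    if "x - emb r \<in> interior unit_square" "x - emb p \<in> approx_square n D k" for x p r
  proof -
    have "x - emb r - emb (p - r) \<in> unit_square"
      using that approx_square_subset_unit_square[OF assms] by auto
    then have "p - r = 0" using interior_unit_square_disjoint_shift that(1) by blast
    then show ?thesis by simp
  qed
  show "interior unit_square \<subseteq> - approx_ext n D k q"
    using *[of _ 0] by (auto simp: approx_ext_def mem_lattice_translates)
  show "lattice_translates (interior unit_square) {q} \<subseteq> - approx_ext n D k q"
    using *[of _ q] unfolding approx_ext_def by (fastforce simp: mem_lattice_translates)
qed

text \<open>Digits are unique representatives of residue classes modulo \<open>n\<close>.\<close>

lemma digit_grid_cong_eq: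
  assumes "d \<in> digit_grid n" "e \<in> digit_grid n"
    and "emb d = emb e + real n *\<^sub>R emb b"
  shows "d = e"
proof -
  have "d = e + (int n * fst b, int n * snd b)"
    using assms(3) unfolding scaleR_emb by (simp flip: emb_simps)
  then have "fst d mod int n = fst e mod int n" "snd d mod int n = snd e mod int n" by simp_all
  then show ?thesis using assms(1,2) by (auto simp: digit_grid_def prod_eq_iff)
qed

section \<open>The fractal square, its approximations and its periodic extension\<close>

locale fractal_square =
  fixes n :: nat and D :: "(int \<times> int) set" and F :: "(real \<times> real) set"
  assumes n: "n \<ge> 2" and D: "D \<subseteq> digit_grid n" and F: "is_fractal_square n D F"
begin

definition H where "H = lattice_translates F UNIV"

lemma n_pos: "n > 0" using n by simp

lemma F_props: "compact F" "F \<noteq> {}" "F = subdivide n D F"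
  using F by (auto simp: is_fractal_square_def)

lemma mem_F: "x \<in> F \<longleftrightarrow> (\<exists>d\<in>D. real n *\<^sub>R x - emb d \<in> F)"
  using mem_subdivide[OF n_pos, of x D F] F_props by simp

lemma F_subset_unit_square: "F \<subseteq> unit_square"
proof -
  text \<open>A coordinate of \<open>F\<close> with range \<open>[a, b]\<close> satisfies \<open>b \<le> (b + n - 1) / n\<close> and \<open>a \<ge> a / n\<close>.\<close>
  have bounds: "0 \<le> f x \<and> f x \<le> 1"
    if cont: "continuous_on F f" and x: "x \<in> F"
      and step: "\<And>y. y \<in> F \<Longrightarrow> \<exists>z\<in>F. \<exists>i. 0 \<le> i \<and> i < int n \<and> real n * f y = f z + real_of_int i"
    for f :: "real \<times> real \<Rightarrow> real" and x
  proof -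
    obtain y where y: "y \<in> F" "\<And>z. z \<in> F \<Longrightarrow> f z \<le> f y"
      using continuous_attains_sup[OF F_props(1,2) cont] by blast
    obtain z i where "z \<in> F" "i < int n" "real n * f y = f z + real_of_int i"
      using step[OF y(1)] by blast
    moreover from this have "real_of_int i \<le> real n - 1" by linarith
    ultimately have "real n * f y \<le> f y + (real n - 1)" using y(2)[of z] by linarith
    then have "(real n - 1) * f y \<le> (real n - 1) * 1" by (simp add: algebra_simps)
    then have "f y \<le> 1" using n by simp
    obtain y' where y': "y' \<in> F" "\<And>z. z \<in> F \<Longrightarrow> f y' \<le> f z"
      using continuous_attains_inf[OF F_props(1,2) cont] by blast
    obtain z i where "z \<in> F" "0 \<le> i" "real n * f y' = f z + real_of_int i"
      using step[OF y'(1)] by blast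
    then have "real n * f y' \<ge> f y'" using y'(2)[of z] by auto
    then have "(real n - 1) * f y' \<ge> (real n - 1) * 0" by (simp add: algebra_simps)
    then have "f y' \<ge> 0" using n by (simp add: zero_le_mult_iff)
    show ?thesis using y(2)[OF x] y'(2)[OF x] \<open>f y \<le> 1\<close> \<open>f y' \<ge> 0\<close> by linarith
  qed
  have fst_step: "\<exists>z\<in>F. \<exists>i. 0 \<le> i \<and> i < int n \<and> real n * fst y = fst z + real_of_int i"
    and snd_step: "\<exists>z\<in>F. \<exists>i. 0 \<le> i \<and> i < int n \<and> real n * snd y = snd z + real_of_int i"
    if y: "y \<in> F" for y
  proof -
    obtain d where d: "d \<in> D" "real n *\<^sub>R y - emb d \<in> F" using y mem_F[of y] by blast
    then have "d \<in> digit_grid n" using D by blast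
    then show "\<exists>z\<in>F. \<exists>i. 0 \<le> i \<and> i < int n \<and> real n * fst y = fst z + real_of_int i"
      and "\<exists>z\<in>F. \<exists>i. 0 \<le> i \<and> i < int n \<and> real n * snd y = snd z + real_of_int i"
      using d by (auto intro!: bexI[OF _ d(2)] simp: emb_def digit_grid_def)
  qed
  show ?thesis
  proof
    fix x assume "x \<in> F"
    from bounds[OF continuous_on_fst[OF continuous_on_id] this fst_step]
      bounds[OF continuous_on_snd[OF continuous_on_id] this snd_step]
    show "x \<in> unit_square" by (simp add: mem_unit_square)
  qed
qed

lemma F_subset_approx_square: "F \<subseteq> approx_square n D k"
proof (induction k)
  case 0
  then show ?case using F_subset_unit_square by (simp add: approx_square_def)
next
  case (Suc k)
  then show ?case using subdivide_mono[OF Suc, of n D] F_props(3) by (simp add: approx_square_Suc)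
qed

text \<open>Points of \<open>unit_square\<close> are within 2 of \<open>F\<close>, and each
  subdivision divides such distances by \<open>n\<close>.\<close>

lemma approx_square_near_F:
  assumes "x \<in> approx_square n D k" shows "\<exists>y\<in>F. dist x y * real n ^ k < 2"
  using assms
proof (induction k arbitrary: x)
  case 0
  obtain y where y: "y \<in> F" using F_props by blast
  then have "x \<in> unit_square" "y \<in> unit_square"
    using 0 F_subset_unit_square by (auto simp: approx_square_def)
  then have "dist x y < 2" unfolding dist_norm
    by (intro norm_lt_2_if_coords_le_1) (auto simp: mem_unit_square)
  then show ?case using y by auto
next
  case (Suc k)
  then obtain d where d: "d \<in> D" "real n *\<^sub>R x - emb d \<in> approx_square n D k"
    using mem_subdivide[OF n_pos] by (auto simp: approx_square_Suc)
  then obtain y where y: "y \<in> F" "dist (real n *\<^sub>R x - emb d) y * real n ^ k < 2"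
    using Suc.IH by blast
  \<comment> \<open>The contraction that takes \<open>n x - d\<close> to \<open>x\<close> takes
    \<open>y\<close> to \<open>y'\<close>.\<close>
  define y' where "y' = (1 / real n) *\<^sub>R (y + emb d)"
  have y': "real n *\<^sub>R y' = y + emb d" using n by (simp add: y'_def)
  then have "y' \<in> F" using mem_F[of y'] d(1) y(1) by (metis add_diff_cancel_right')
  moreover have "dist (real n *\<^sub>R x - emb d) y = real n * dist x y'"
  proof -
    have "real n *\<^sub>R x - emb d - y = real n *\<^sub>R (x - y')" using y' by (simp add: algebra_simps)
    then show ?thesis by (simp add: dist_norm)
  qed
  ultimately show ?case using y(2) by (auto simp: mult_ac intro!: bexI[of _ y'])
qed

lemma H_periodic: "x + emb p \<in> H \<longleftrightarrow> x \<in> H"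
  unfolding H_def by (rule lattice_translates_UNIV_periodic)

lemma closed_H: "closed H"
  unfolding H_def using F_props(1) by (rule closed_lattice_translates_UNIV)

text \<open>This is \<open>n F = F + D\<close>, combined with periodicity under the lattice.\<close>

lemma H_expand: assumes "x \<in> H" shows "real n *\<^sub>R x \<in> H"
proof -
  obtain p where p: "x - emb p \<in> F" using assms by (auto simp: H_def mem_lattice_translates)
  obtain d where d: "real n *\<^sub>R (x - emb p) - emb d \<in> F" using p mem_F[of "x - emb p"] by blast
  have "real n *\<^sub>R x - emb ((int n * fst p, int n * snd p) + d) \<in> F"
    using d unfolding emb_simps scaleR_emb[symmetric] by (simp add: algebra_simps)
  then show ?thesis unfolding H_def mem_lattice_translates by blast
qed

text \<open>A translate \<open>r + F\<close> of \<open>n H\<close>, seen from \<open>d\<close>, has \<open>r \<noteq> 0\<close> and \<open>r \<noteq> q\<close>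
  because neither \<open>d\<close> nor \<open>e\<close> is congruent modulo \<open>n\<close> to an element of \<open>D\<close>.\<close>

lemma transfer_connection:
  assumes d: "d \<in> digit_grid n - D" "e \<in> digit_grid n - D"
    and q: "emb q = emb e + real n *\<^sub>R emb b - emb d"
    and conn: "connected_component (- lattice_translates F (UNIV - {0, q})) x (y + emb q)"
  shows "connected_component (- H) ((1 / real n) *\<^sub>R (x + emb d)) ((1 / real n) *\<^sub>R (y + emb e) + emb b)"
proof -
  \<comment> \<open>\<open>f\<close> carries the unit square at 0 onto the subsquare at
    \<open>d / n\<close>, and the one at \<open>q\<close> onto the subsquare at
    \<open>e / n + b\<close>.\<close>
  define f where "f z = (1 / real n) *\<^sub>R (z + emb d)" for z
  have "z \<in> lattice_translates F (UNIV - {0, q})" if "f z \<in> H" for z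
  proof -
    obtain p where p: "f z - emb p \<in> F" using \<open>f z \<in> H\<close> by (auto simp: H_def mem_lattice_translates)
    obtain c where c: "c \<in> D" "real n *\<^sub>R (f z - emb p) - emb c \<in> F"
      using p mem_F[of "f z - emb p"] by blast
    \<comment> \<open>\<open>f\<close> maps \<open>F + r\<close> onto the piece
      \<open>(F + c) / n + p\<close> of \<open>H\<close>, so \<open>r\<close> indexes a translate of
      \<open>F\<close> that contains \<open>z\<close>.\<close>
    define r where "r = c + (int n * fst p, int n * snd p) - d"
    have r: "emb r = emb c + real n *\<^sub>R emb p - emb d"
      unfolding r_def emb_simps scaleR_emb by simp
    have "real n *\<^sub>R (f z - emb p) - emb c = z - emb r"
      using n unfolding r by (simp add: f_def algebra_simps)
    moreover have "r \<noteq> 0"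
    proof
      assume "r = 0"
      then have "emb d = emb c + real n *\<^sub>R emb p" using r by simp
      then show False using digit_grid_cong_eq[of d n c p] d c(1) D by auto
    qed
    moreover have "r \<noteq> q"
    proof
      assume "r = q"
      then have "emb c = emb e + real n *\<^sub>R emb (b - p)" using r q by (simp add: algebra_simps)
      then show False using digit_grid_cong_eq[of c n e "b - p"] d c(1) D by auto
    qed
    ultimately show ?thesis using c(2) by (auto simp: mem_lattice_translates)
  qed
  then have "connected_component (- H) (f x) (f (y + emb q))"
    by (intro connected_component_image[OF conn]) (auto simp: f_def intro!: continuous_intros)
  moreover have "f (y + emb q) = (1 / real n) *\<^sub>R (y + emb e) + emb b"
    using n unfolding f_def q by (simp add: algebra_simps)
  ultimately show ?thesis by (simp add: f_def)
qed

section \<open>From \<open>Qset\<close> to connections and back\<close>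

text \<open>Puts the convention for \<open>k = 0\<close> and the case \<open>k >= 1\<close> into one
  form that mentions only \<open>F\<close>. For \<open>k = 0\<close> the segment between the centres
  works; otherwise the given component does, since \<open>F\<close> lies in every
  approximation.\<close>

lemma Qset_connects_centres:
  assumes "q \<in> Qset n D k"
  shows "connected_component (- lattice_translates F (UNIV - {0, q})) (1/2, 1/2) ((1/2, 1/2) + emb q)"
proof (cases "k = 0")
  case True
  then have q: "q \<in> {(0, 0), (1, 0), (-1, 0), (0, 1), (0, -1)}" using assms by (simp add: Qset_def)
  have segment: "(1 - t) *\<^sub>R a + t *\<^sub>R (a + emb q) = a + t *\<^sub>R emb q" for t a
    by (simp add: algebra_simps)
  have "closed_segment (1/2, 1/2) ((1/2, 1/2) + emb q) \<subseteq> - lattice_translates F (UNIV - {0, q})"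
  proof
    fix x assume "x \<in> closed_segment (1/2, 1/2) ((1/2, 1/2) + emb q)"
    then obtain t where t: "0 \<le> t" "t \<le> 1" "x = (1/2, 1/2) + t *\<^sub>R emb q"
      unfolding closed_segment_image_interval by (auto simp only: segment image_iff atLeastAtMost_iff)
    have "p \<in> {0, q}" if "x - emb p \<in> unit_square" for p
    proof -
      have "0 \<le> 1/2 + t * fst q - fst p" "1/2 + t * fst q - fst p \<le> 1"
        "0 \<le> 1/2 + t * snd q - snd p" "1/2 + t * snd q - snd p \<le> 1"
        using that t(3) by (simp_all add: mem_unit_square emb_def)
      moreover have "i = 0 \<or> i = s"
        if "s \<in> {-1, 0, 1}" "0 \<le> 1/2 + t * real_of_int s - real_of_int i"
          "1/2 + t * real_of_int s - real_of_int i \<le> 1" for s i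
      proof -
        consider "s = -1" | "s = 0" | "s = 1" using \<open>s \<in> {-1, 0, 1}\<close> by blast
        then show ?thesis
        proof cases
          case 1
          then have "0 \<le> 1/2 - t - real_of_int i" "1/2 - t - real_of_int i \<le> 1"
            using that by simp_all
          then show ?thesis using t 1 by linarith
        next
          case 2
          then have "0 \<le> 1/2 - real_of_int i" "1/2 - real_of_int i \<le> 1"
            using that by simp_all
          then show ?thesis by linarith
        next
          case 3
          then have "0 \<le> 1/2 + t - real_of_int i" "1/2 + t - real_of_int i \<le> 1"
            using that by simp_all
          then show ?thesis using t 3 by linarith
        qed
      qed
      moreover have "fst q \<in> {-1, 0, 1}" "snd q \<in> {-1, 0, 1}" using q by auto
      ultimately have "fst p = 0 \<or> fst p = fst q" "snd p = 0 \<or> snd p = snd q" by blast+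
      \<comment> \<open>Since \<open>q\<close> has a zero coordinate, the coordinatewise
        alternatives leave only \<open>p = 0\<close> and \<open>p = q\<close>.\<close>
      then show ?thesis using q by (auto simp: prod_eq_iff)
    qed
    then show "x \<in> - lattice_translates F (UNIV - {0, q})"
      using F_subset_unit_square by (auto simp: mem_lattice_translates)
  qed
  then show ?thesis unfolding connected_component_def
    by (intro exI[of _ "closed_segment (1/2, 1/2) ((1/2, 1/2) + emb q)"]) auto
next
  case False
  then obtain C where C: "C \<in> components (- approx_ext n D k q)" "interior unit_square \<subseteq> C"
    "lattice_translates (interior unit_square) {q} \<subseteq> C"
    using assms by (auto simp: Qset_def)
  have "(1/2, 1/2) \<in> interior unit_square" by (simp add: mem_interior_unit_square)
  then have "(1/2, 1/2) \<in> C" "(1/2, 1/2) + emb q \<in> C"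
    using C(2,3) unfolding lattice_translates_def by blast+
  moreover have "lattice_translates F (UNIV - {0, q}) \<subseteq> approx_ext n D k q"
    unfolding approx_ext_def by (intro lattice_translates_mono F_subset_approx_square) auto
  then have "C \<subseteq> - lattice_translates F (UNIV - {0, q})"
    using in_components_subset[OF C(1)] by blast
  ultimately show ?thesis unfolding connected_component_def
    using in_components_connected[OF C(1)] by blast
qed

text \<open>A compact set in \<open>- H\<close> has positive distance from the closed set
  \<open>H\<close>, while the approximations at level \<open>k\<close> stay within
  \<open>2 / n^k\<close> of \<open>H\<close>.\<close>

lemma path_in_Compl_H_avoids_approx:
  assumes "compact K" "K \<subseteq> - H"
  obtains k where "k \<ge> 1" "K \<subseteq> - lattice_translates (approx_square n D k) UNIV"
proof -
  obtain r where r: "r > 0" "\<And>x y. x \<in> K \<Longrightarrow> y \<in> H \<Longrightarrow> r \<le> dist x y"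
    using separate_compact_closed[of K H] closed_H assms by blast
  obtain k where k: "2 / r < real n ^ k" using n real_arch_pow[of "real n" "2 / r"] by auto
  \<comment> \<open>Passing to \<open>Suc k\<close> guarantees a level of at least 1, because
    \<open>Qset\<close> at level 0 is a separate convention.\<close>
  also have "\<dots> \<le> real n ^ Suc k" using n by simp
  finally have k': "2 < r * real n ^ Suc k" using r by (simp add: field_simps)
  have "x \<notin> lattice_translates (approx_square n D (Suc k)) UNIV" if "x \<in> K" for x
  proof
    assume "x \<in> lattice_translates (approx_square n D (Suc k)) UNIV"
    then obtain p where "x - emb p \<in> approx_square n D (Suc k)"
      by (auto simp: mem_lattice_translates)
    then obtain y where y: "y \<in> F" "dist (x - emb p) y * real n ^ Suc k < 2"
      using approx_square_near_F by blast
    have "y + emb p \<in> H" using y(1) unfolding H_def lattice_translates_def by blast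
    then have "r \<le> dist (x - emb p) y"
      using r(2)[OF \<open>x \<in> K\<close>] by (metis diff_diff_eq2 diff_diff_eq dist_norm add.commute)
    then have "r * real n ^ Suc k \<le> dist (x - emb p) y * real n ^ Suc k"
      by (intro mult_right_mono) auto
    then show False using y k' by linarith
  qed
  then have "K \<subseteq> - lattice_translates (approx_square n D (Suc k)) UNIV" by blast
  then show ?thesis by (intro that[of "Suc k"]) auto
qed

text \<open>\<open>C\<close> may come arbitrarily close to \<open>H\<close>, so a compact path from
  \<open>x\<close> to \<open>y\<close> replaces it. Shifted by \<open>- p\<close> and joined with
  the open squares at 0 and \<open>q\<close>, it is a connected set avoiding
  \<open>approx_ext n D k q\<close>.\<close>

lemma connection_imp_Qset:
  assumes x: "x - emb p \<in> interior unit_square" and y: "y - emb (p + q) \<in> interior unit_square"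
    and C: "C \<in> components (- H)" "x \<in> C" "y \<in> C"
  shows "\<exists>k. q \<in> Qset n D k"
proof -
  have "path_connected C"
    using C(1) closed_H by (metis connected_open_path_connected in_components_connected
        open_Compl open_components)
  then obtain g where g: "path g" "path_image g \<subseteq> C" "pathstart g = x" "pathfinish g = y"
    using C(2,3) unfolding path_connected_def by blast
  obtain k where k: "k \<ge> 1" "path_image g \<subseteq> - lattice_translates (approx_square n D k) UNIV"
    using path_in_Compl_H_avoids_approx[OF compact_path_image[OF g(1)]] g(2)
      in_components_subset[OF C(1)] by blast
  define P where "P = (\<lambda>z. z - emb p) ` path_image g"
  define J where "J = lattice_translates (interior unit_square) {q}"
  have J_eq: "J = (\<lambda>z. z + emb q) ` interior unit_square"
    unfolding J_def lattice_translates_def by blast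
  have P: "x - emb p \<in> P" "y - emb p \<in> P" using g by (auto simp: P_def)
  have "connected P" unfolding P_def
    using g(1) by (intro connected_continuous_image continuous_intros) auto
  moreover have "connected J" unfolding J_eq
    by (intro connected_continuous_image continuous_intros convex_connected
        convex_interior_unit_square)
  moreover have "y - emb p \<in> J" using y by (auto simp: J_def mem_lattice_translates algebra_simps)
  ultimately have "connected (interior unit_square \<union> (P \<union> J))"
    using x P convex_connected[OF convex_interior_unit_square] by (intro connected_Un) auto
  moreover have "interior unit_square \<union> (P \<union> J) \<subseteq> - approx_ext n D k q"
  proof -
    have "z + - emb p \<notin> lattice_translates (approx_square n D k) UNIV" if "z \<in> path_image g" for z
      using that k(2) unfolding emb_simps(4)[symmetric] lattice_translates_UNIV_periodic by blast
    moreover have "approx_ext n D k q \<subseteq> lattice_translates (approx_square n D k) UNIV"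
      unfolding approx_ext_def by (intro lattice_translates_mono) auto
    ultimately have "P \<subseteq> - approx_ext n D k q" by (auto simp: P_def)
    then show ?thesis using interior_unit_square_subset_approx_ext[OF n_pos D, where k = k and q = q]
      by (simp add: J_def)
  qed
  moreover have "interior unit_square \<union> (P \<union> J) \<noteq> {}" using P by blast
  ultimately obtain B where "B \<in> components (- approx_ext n D k q)"
    "interior unit_square \<union> (P \<union> J) \<subseteq> B"
    by (metis exists_component_superset subset_empty)
  then have "q \<in> Qset n D k" using k(1) by (auto simp: Qset_def J_def)
  then show ?thesis ..
qed

text \<open>Pigeonhole: among the infinitely many squares indexed by \<open>floor_vec\<close>, two
  distinct ones agree modulo \<open>n\<close> in both coordinates.\<close>

lemma unbounded_component_imp_Qset:
  assumes C: "C \<in> components (- H)" "\<not> bounded C"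
  shows "\<exists>k b. b \<noteq> 0 \<and> (int n * fst b, int n * snd b) \<in> Qset n D k"
proof -
  define f where "f z = (fst z mod int n, snd z mod int n)" for z :: "int \<times> int"
  have "f ` floor_vec ` C \<subseteq> digit_grid n"
    using n by (auto simp: f_def digit_grid_def)
  then have "finite (f ` floor_vec ` C)" by (rule finite_subset) (simp add: digit_grid_def)
  then obtain z where z: "z \<in> floor_vec ` C" "infinite {a \<in> floor_vec ` C. f a = f z}"
    using pigeonhole_infinite infinite_floor_vec_image[OF C(2)] by blast
  have "\<not> {a \<in> floor_vec ` C. f a = f z} \<subseteq> {z}" using z(2) finite_subset by blast
  then obtain a where a: "a \<in> floor_vec ` C" "f a = f z" "a \<noteq> z" by blast
  have "int n dvd fst a - fst z" "int n dvd snd a - snd z"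
    using a(2) by (auto simp: f_def mod_eq_dvd_iff)
  then obtain i j where "fst a - fst z = int n * i" "snd a - snd z = int n * j"
    by (auto simp: dvd_def)
  then have q: "a = z + (int n * i, int n * j)" by (simp add: prod_eq_iff)
  \<comment> \<open>Openness is what lets \<open>C\<close> reach the interior of a square that it
    might otherwise meet only on an edge.\<close>
  have "open C" using C(1) closed_H open_components by blast
  then have "\<exists>y\<in>C. y - emb w \<in> interior unit_square" if "w \<in> floor_vec ` C" for w
    using that open_meets_floor_square by blast
  then obtain x y where "x \<in> C" "x - emb z \<in> interior unit_square"
    "y \<in> C" "y - emb a \<in> interior unit_square" using z(1) a(1) by meson
  then obtain k where "(int n * i, int n * j) \<in> Qset n D k"
    using connection_imp_Qset C(1) q by blast
  moreover have "(i, j) \<noteq> 0" using q a(3) by (auto simp: zero_prod_def)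
  ultimately show ?thesis by (intro exI[of _ k] exI[of _ "(i, j)"]) simp
qed

section \<open>Walks in the graph and the two implications\<close>

lemma edge_connects:
  assumes "(u, v, b) \<in> arcs (graph_of n D (Qset n D k))"
  shows "connected_component (- H) (u + (1 / real n) *\<^sub>R (1/2, 1/2)) (v + (1 / real n) *\<^sub>R (1/2, 1/2) + emb b)"
proof -
  obtain d e q where d: "d \<in> digit_grid n - D" "u = (1 / real n) *\<^sub>R emb d"
    and e: "e \<in> digit_grid n - D" "v = (1 / real n) *\<^sub>R emb e"
    and q: "q \<in> Qset n D k" "real n *\<^sub>R (v + emb b - u) = emb q"
    using assms by (auto simp: graph_of_def vertex_set_def)
  have "emb q = emb e + real n *\<^sub>R emb b - emb d"
    unfolding q(2)[symmetric] d e using n by (simp add: algebra_simps)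
  from transfer_connection[OF d(1) e(1) this Qset_connects_centres[OF q(1)]]
  show ?thesis unfolding d e by (simp only: scaleR_add_right add.commute)
qed

text \<open>The walk is lifted to the plane: each edge leads to a lattice translate of the next
  vertex's subsquare, and the labels add up to the total shift.\<close>

lemma walk_connects:
  assumes "pre_digraph.awalk (graph_of n D (Qset n D k)) u p v" "p \<noteq> []"
  shows "connected_component (- H) (u + (1 / real n) *\<^sub>R (1/2, 1/2))
    (v + (1 / real n) *\<^sub>R (1/2, 1/2) + emb (sum_list (map arc_label p)))"
  using assms
proof (induction p arbitrary: u)
  case (Cons a p)
  obtain w b where a: "a = (u, w, b)" "(u, w, b) \<in> arcs (graph_of n D (Qset n D k))"
    and p: "pre_digraph.cas (graph_of n D (Qset n D k)) w p v"
      "set p \<subseteq> arcs (graph_of n D (Qset n D k))"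
    using Cons.prems(1)
    by (cases a) (auto simp: pre_digraph.awalk_def pre_digraph.cas.simps graph_of_def)
  note edge = edge_connects[OF a(2)]
  show ?case
  proof (cases "p = []")
    case True
    then show ?thesis using edge p(1) by (simp add: a arc_label_def pre_digraph.cas.simps)
  next
    case False
    have "w \<in> verts (graph_of n D (Qset n D k))" using a(2) by (simp add: graph_of_def)
    then have "connected_component (- H) (w + (1 / real n) *\<^sub>R (1/2, 1/2))
        (v + (1 / real n) *\<^sub>R (1/2, 1/2) + emb (sum_list (map arc_label p)))"
      using Cons.IH[OF _ False, of w] p by (simp add: pre_digraph.awalk_def)
    \<comment> \<open>The lift of the remaining walk is shifted by the first label \<open>b\<close>,
      so that it starts where the first edge ends.\<close>
    then have "connected_component (- H) (w + (1 / real n) *\<^sub>R (1/2, 1/2) + emb b)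
        (v + (1 / real n) *\<^sub>R (1/2, 1/2) + emb (sum_list (map arc_label p)) + emb b)"
      using connected_component_translate H_periodic by (metis Compl_iff)
    moreover have "arc_label a = b" by (simp add: a arc_label_def)
    ultimately show ?thesis
      using connected_component_trans[OF edge] by (simp add: add_ac)
  qed
qed simp

lemma nonzero_loop_imp_unbounded:
  assumes "has_nonzero_loop (graph_of n D (Qset n D k))" "A \<in> components (- H)"
  shows "\<not> bounded A"
proof -
  obtain u p where up: "p \<noteq> []" "pre_digraph.awalk (graph_of n D (Qset n D k)) u p u"
    "sum_list (map arc_label p) \<noteq> 0"
    using assms(1) by (auto simp: has_nonzero_loop_def)
  note unb = period_imp_unbounded_component[OF H_periodic walk_connects[OF up(2,1)] up(3)]
  show ?thesis
    using all_components_unbounded[OF n closed_H H_periodic H_expand unb assms(2)] .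
qed

text \<open>A digit \<open>d\<close> outside \<open>D\<close> is used twice: the centre of its
  subsquare shows that \<open>- H\<close> has a component at all, and its vertex carries the
  one-edge loop.\<close>

lemma unbounded_imp_nonzero_loop:
  assumes "card D < n\<^sup>2" and unb: "\<And>C. C \<in> components (- H) \<Longrightarrow> \<not> bounded C"
  shows "\<exists>k. has_nonzero_loop (graph_of n D (Qset n D k))"
proof -
  have "card (digit_grid n) = n\<^sup>2" by (simp add: digit_grid_def power2_eq_square)
  then obtain d where d: "d \<in> digit_grid n - D" using assms(1) D
    by (metis Diff_eq_empty_iff all_not_in_conv nat_less_le subset_antisym)
  define u where "u = (1 / real n) *\<^sub>R emb d"
  have u: "u \<in> vertex_set n D" using d by (auto simp: u_def vertex_set_def)
  \<comment> \<open>With \<open>q = 0\<close> the transferred connection is trivial; it only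
    certifies that the centre lies in \<open>- H\<close>.\<close>
  have "(0, 0) \<in> Qset n D 0" by (simp add: Qset_def)
  from transfer_connection[OF d d _ Qset_connects_centres[OF this], of 0]
  have "connected_component (- H) ((1 / real n) *\<^sub>R ((1/2, 1/2) + emb d))
      ((1 / real n) *\<^sub>R ((1/2, 1/2) + emb d) + emb 0)"
    by (simp add: zero_prod_def[symmetric] del: scaleR_Pair)
  then have "- H \<noteq> {}" using connected_component_in by blast
  then obtain C where "C \<in> components (- H)" using components_eq_empty by blast
  then obtain k b where b: "b \<noteq> 0" "(int n * fst b, int n * snd b) \<in> Qset n D k"
    using unbounded_component_imp_Qset unb by blast
  have "pre_digraph.awalk (graph_of n D (Qset n D k)) u [(u, u, b)] u"
    using u b(2) by (auto simp: pre_digraph.awalk_def pre_digraph.cas.simps graph_of_def scaleR_emb)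
  then show ?thesis using b(1) unfolding has_nonzero_loop_def
    by (intro exI[of _ k] exI[of _ u] exI[of _ "[(u, u, b)]"]) (simp add: arc_label_def)
qed

end

theorem theorem4p6:
  fixes n :: nat and D :: "(int \<times> int) set" and F H :: "(real \<times> real) set"
  assumes "n \<ge> 2"
    and "D \<subseteq> digit_grid n"
    and "1 < card D" and "card D < n\<^sup>2"
    and "is_fractal_square n D F"
    and "H = lattice_translates F UNIV"
  shows "(\<forall>C \<in> components (- H). \<not> bounded C) \<longleftrightarrow>
         (\<exists>k. has_nonzero_loop (graph_of n D (Qset n D k)))"
proof -
  interpret fs: fractal_square n D F using assms by unfold_locales
  have "fs.H = H" using assms(6) by (simp add: fs.H_def)
  then show ?thesis
    using fs.unbounded_imp_nonzero_loop[OF assms(4)] fs.nonzero_loop_imp_unbounded by metis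
qed

end
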